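(* Let $\mathcal{H}$ be a nonempty finite set, and let $P:\mathcal{H}\rightarrow[0,1]$ be given by $P(h)=\frac{1}{|\mathcal{H}|}$ for all $h\in\mathcal{H}$. Then for every function $Q:\mathcal{H}\rightarrow[0,1]$ with $\sum_{h\in\mathcal{H}}Q(h)=1$, $$\mathrm{KL}(Q,P)\;\leq\;\log\sum_{h\in\mathcal{H}}Q(h)^2+\log(|\mathcal{H}|).$$
   Context: Here $\log$ denotes the natural logarithm. For two functions $Q,P:\mathcal{H}\rightarrow[0,1]$ on a finite set $\mathcal{H}$, the Kullback-Leibler divergence is defined as $$\mathrm{KL}(Q,P)=\sum_{h\in\mathcal{H}}Q(h)\log\frac{Q(h)}{P(h)},$$ with the usual convention that a term with $Q(h)=0$ equals $0$. *)

theory Defs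
  imports Complex_Main "HOL-Library.FuncSet"
begin

(* A term with Q h = 0 is 0 because 0 * x = 0.  A point with P h = 0 < Q h, where the divergence
   is conventionally infinite, would also contribute 0 (ln (x / 0) = ln 0 = 0), so KL H Q P has
   its usual meaning only if P h = 0 implies Q h = 0 on H; a uniform P is positive on H. *)
definition KL :: "'a set \<Rightarrow> ('a \<Rightarrow> real) \<Rightarrow> ('a \<Rightarrow> real) \<Rightarrow> real" where
  "KL H Q P = (\<Sum>h\<in>H. Q h * ln (Q h / P h))"

end

(* The tangent bound ln x <= x - 1 at x = Q h / S with S = (\<Sum>h. (Q h)^2) gives
   ln (Q h) <= ln S + Q h / S - 1.  Averaging with weights Q h, the last two terms cancel. *)
theory Submission
  imports Defs
begin

text \<open>For uniform \<open>P\<close>, the divergence is the \<open>Q\<close>-mean of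
  \<open>ln (Q h)\<close> plus \<open>ln (real (card H))\<close>. The claim is thus Jensen's
  inequality for the concave \<open>ln\<close>: the mean of \<open>ln (Q h)\<close> is at most
  \<open>ln\<close> of the mean of \<open>Q h\<close>, which is the sum of squares.\<close>

theorem proposition1:
  fixes H :: "'a set" and P Q :: "'a \<Rightarrow> real"
  assumes "finite H" and "H \<noteq> {}"
    and "P \<in> H \<rightarrow> {0..1}"
    and "\<And>h. h \<in> H \<Longrightarrow> P h = 1 / real (card H)"
    and "Q \<in> H \<rightarrow> {0..1}"
    and "(\<Sum>h\<in>H. Q h) = 1"
  shows "KL H Q P \<le> ln (\<Sum>h\<in>H. (Q h)\<^sup>2) + ln (real (card H))"
proof -
  define S where "S = (\<Sum>h\<in>H. (Q h)\<^sup>2)"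
  define n where "n = real (card H)"
  have n: "n > 0"
    using assms(1,2) by (simp add: n_def card_gt_0_iff)
  have "\<exists>h\<in>H. Q h \<noteq> 0"
    using assms(6) by (metis sum.neutral zero_neq_one)
  then have S: "S > 0"
    unfolding S_def using assms(1) by (auto intro: sum_pos2)
  \<comment> \<open>The weight \<open>Q h\<close> is kept in the bound so that points with
    \<open>Q h = 0\<close> are covered too: both sides vanish there, while the tangent bound needs
    \<open>Q h > 0\<close>.\<close>
  have term_bound: "Q h * ln (Q h / P h) \<le> Q h * (ln S + ln n - 1) + (Q h)\<^sup>2 / S" if h: "h \<in> H" for h
  proof (cases "Q h = 0")
    case False
    then have Q: "Q h > 0"
      using assms(5) h by (auto simp: Pi_iff order.order_iff_strict)
    have "ln (Q h / P h) = ln (Q h) + ln n"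
      using Q n assms(4)[OF h] by (simp add: n_def ln_mult)
    also have "ln (Q h) = ln (Q h / S) + ln S"
      using Q S by (simp add: ln_div)
    also have "ln (Q h / S) \<le> Q h / S - 1"
      using Q S by (intro ln_le_minus_one) simp
    finally have "Q h * ln (Q h / P h) \<le> Q h * (Q h / S - 1 + ln S + ln n)"
      using Q by (intro mult_left_mono) auto
    then show ?thesis
      by (simp add: algebra_simps power2_eq_square)
  qed simp
  have "KL H Q P \<le> (\<Sum>h\<in>H. Q h * (ln S + ln n - 1) + (Q h)\<^sup>2 / S)"
    unfolding KL_def by (intro sum_mono term_bound)
  also have "\<dots> = (\<Sum>h\<in>H. Q h) * (ln S + ln n - 1) + S / S"
    by (simp add: S_def sum.distrib sum_distrib_right flip: sum_divide_distrib)
  \<comment> \<open>Since \<open>S\<close> is the \<open>Q\<close>-mean of \<open>Q\<close>, the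
    tangent's linear part averages to \<open>S / S = 1\<close> and offsets the
    \<open>- 1\<close>.\<close>
  also have "\<dots> = ln S + ln n"
    using S assms(6) by simp
  finally show ?thesis
    by (simp add: S_def n_def)
qed

end
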